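(* Let $\alpha,\theta>0$ and let $\{N(t),\,t\ge0\}$ be a Bell-Touchard process with parameters $(\alpha,\theta)$. Let $\{M(t),\,t\ge0\}$ be a Poisson process with rate $\alpha(e^\theta-1)$ and let $\{X_i\}_{i\ge1}$ be a sequence of independent and identically distributed random variables, independent of $\{M(t),\,t\ge0\}$, with $$\Pr[X_i=x]=\frac{\theta^x/x!}{e^\theta-1},\qquad x\in\mathbb{N}.$$ Then, for every $t\ge0$, $$N(t)\stackrel{d}{=}\sum_{i=1}^{M(t)}X_i ,$$ where $\stackrel{d}{=}$ denotes equality in distribution.
   Context: $\mathbb{N}=\{1,2,\dots\}$, $\mathbb{N}_0=\mathbb{N}\cup\{0\}$. A counting process $\{N(t),t\ge0\}$ is an $\mathbb{N}_0$-valued stochastic process where $N(t)$ is the number of events that have occurred up to time $t$ (so it is nondecreasing in $t$). A function $f:\mathbb{R}\to\mathbb{R}$ is $o(s)$ if $\lim_{s\to0}f(s)/s=0$. A counting process is a Bell-Touchard process with parameters $(\alpha,\theta)$, $\alpha,\theta>0$, if (1) $N(0)=0$; (2) it has stationary and independent increments; (3) $\Pr[N(t+s)-N(t)=k]=\alpha s\,\theta^k/k!+o(s)$ for every $k\in\mathbb{N}$ and $s,t>0$. An empty sum is $0$. *)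

theory Defs
  imports "HOL-Probability.Probability"
begin

context prob_space
begin

text \<open>
  A process is a map \<open>N t \<omega>\<close>; only its values at times \<open>t \<ge> 0\<close> are constrained and used.
  Paths are not assumed to be right continuous. Since they are nondecreasing, the truncated
  subtraction of \<^typ>\<open>nat\<close> gives the true increments \<open>N v \<omega> - N u \<omega>\<close> for \<open>0 \<le> u \<le> v\<close>.
\<close>

definition counting_process :: "(real \<Rightarrow> 'a \<Rightarrow> nat) \<Rightarrow> bool" where
  "counting_process N \<longleftrightarrow>
     (\<forall>t\<ge>0. random_variable (count_space UNIV) (N t)) \<and>
     (\<forall>\<omega>\<in>space M. mono_on {0..} (\<lambda>t. N t \<omega>))"

definition stationary_increments :: "(real \<Rightarrow> 'a \<Rightarrow> nat) \<Rightarrow> bool" where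
  "stationary_increments N \<longleftrightarrow>
     (\<forall>s\<ge>0. \<forall>t\<ge>0. \<forall>u\<ge>0.
        distr M (count_space UNIV) (\<lambda>\<omega>. N (t + s) \<omega> - N t \<omega>) =
        distr M (count_space UNIV) (\<lambda>\<omega>. N (u + s) \<omega> - N u \<omega>))"

definition independent_increments :: "(real \<Rightarrow> 'a \<Rightarrow> nat) \<Rightarrow> bool" where
  "independent_increments N \<longleftrightarrow>
     (\<forall>(n::nat) \<tau>. 0 \<le> \<tau> 0 \<and> strict_mono_on {..n} \<tau> \<longrightarrow>
        indep_vars (\<lambda>_. count_space UNIV) (\<lambda>i \<omega>. N (\<tau> (Suc i)) \<omega> - N (\<tau> i) \<omega>) {..<n})"

text \<open>
  The remainder in the third axiom is only determined for \<open>s > 0\<close>, hence the one-sided filter.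
\<close>

definition bell_touchard_process :: "real \<Rightarrow> real \<Rightarrow> (real \<Rightarrow> 'a \<Rightarrow> nat) \<Rightarrow> bool" where
  "bell_touchard_process \<alpha> \<theta> N \<longleftrightarrow>
     \<alpha> > 0 \<and> \<theta> > 0 \<and>
     counting_process N \<and>
     (\<forall>\<omega>\<in>space M. N 0 \<omega> = 0) \<and>
     stationary_increments N \<and>
     independent_increments N \<and>
     (\<forall>k\<ge>1. \<forall>t>0.
        (\<lambda>s. prob {\<omega> \<in> space M. N (t + s) \<omega> - N t \<omega> = k} - \<alpha> * s * (\<theta> ^ k / fact k))
          \<in> o[at_right 0](\<lambda>s. s))"

definition poisson_process :: "real \<Rightarrow> (real \<Rightarrow> 'a \<Rightarrow> nat) \<Rightarrow> bool" where
  "poisson_process r N \<longleftrightarrow>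
     r > 0 \<and>
     counting_process N \<and>
     (\<forall>\<omega>\<in>space M. N 0 \<omega> = 0) \<and>
     independent_increments N \<and>
     (\<forall>t\<ge>0. \<forall>s>0. \<forall>k.
        prob {\<omega> \<in> space M. N (t + s) \<omega> - N t \<omega> = k} = pmf (poisson_pmf (r * s)) k)"

definition iid_vars :: "'b measure \<Rightarrow> ('i \<Rightarrow> 'a \<Rightarrow> 'b) \<Rightarrow> 'i set \<Rightarrow> bool" where
  "iid_vars S X I \<longleftrightarrow>
     indep_vars (\<lambda>_. S) X I \<and> (\<forall>i\<in>I. \<forall>j\<in>I. distr M S (X i) = distr M S (X j))"

text \<open>
  Independence of the whole families \<open>X\<close> and \<open>Y\<close>, through the sigma-algebras they generate.
  (\<^const>\<open>indep_var\<close> applied to the two families as random elements of product spaces would force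
  them to have the same type.)
\<close>

definition generated_sigma :: "'b measure \<Rightarrow> ('i \<Rightarrow> 'a \<Rightarrow> 'b) \<Rightarrow> 'i set \<Rightarrow> 'a set set" where
  "generated_sigma S X I =
     sigma_sets (space M) (\<Union>i\<in>I. {X i -` A \<inter> space M | A. A \<in> sets S})"

definition indep_families ::
  "'b measure \<Rightarrow> ('i \<Rightarrow> 'a \<Rightarrow> 'b) \<Rightarrow> 'i set \<Rightarrow> 'c measure \<Rightarrow> ('j \<Rightarrow> 'a \<Rightarrow> 'c) \<Rightarrow> 'j set \<Rightarrow> bool" where
  "indep_families S X I T Y J \<longleftrightarrow>
     indep_set (generated_sigma S X I) (generated_sigma T Y J)"

end

end

theory Submission
  imports Defs "HOL-Real_Asymp.Real_Asymp"
begin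

text \<open>
  Both sides have the generating function \<open>z \<mapsto> exp (t * \<alpha> * (exp (\<theta> * z) - exp \<theta>))\<close> on \<open>0 \<le> z < 1\<close>,
  and a law on the naturals is determined by its generating function there
  (\<open>distr_eq_if_pgf_eq\<close>).

  For the random sum this is the composition rule \<open>pgf_random_sum\<close>, applied to a Poisson number of
  summands whose law is a Poisson law conditioned on being positive.

  For the process, write \<open>G t z\<close> for the generating function of \<open>N t\<close>. Cutting \<open>[0, t]\<close> into \<open>n\<close>
  equal pieces gives \<open>G t z = G (t / n) z ^ n\<close>. As soon as \<open>G t z > 0\<close>, such \<open>n\<close>-th roots satisfy
  \<open>n * (G (t / n) z - 1) \<longlonglongrightarrow> ln (G t z)\<close>. The same limit can be computed coefficientwise. Each
  coefficient of positive index \<open>k\<close>, that is \<open>n\<close> times the probability of \<open>k\<close> events before \<open>t / n\<close>,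
  tends to \<open>t * \<alpha> * \<theta> ^ k / fact k\<close> by the infinitesimal axiom.

  The axiom is not uniform in \<open>k\<close>, so it does not by itself give the probability of no event. The
  constant coefficient is therefore left as the unknown \<open>ln (G t 0)\<close>, finite because a positive
  probability of no event is forced by the finiteness of the count
  (\<open>stationary_independent_pgf_0_pos\<close>). This same constant bounds the other rescaled coefficients,
  so Tannery's theorem exchanges the limit with the series for every fixed \<open>z < 1\<close> and
  yields \<open>ln (G t z) = ln (G t 0) + t * \<alpha> * (exp (\<theta> * z) - 1)\<close>. Finally \<open>G t z\<close> tends to 1 as \<open>z\<close>
  tends to 1, since the count is finite, and this determines \<open>G t 0\<close>.
\<close>

section \<open>Probability generating functions\<close>

definition pgf :: "'a measure \<Rightarrow> ('a \<Rightarrow> nat) \<Rightarrow> real \<Rightarrow> real" where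
  "pgf M X z = (\<integral>\<omega>. z ^ X \<omega> \<partial>M)"

text \<open>
  Splitting an expectation along the values of a discrete variable serves twice: along \<open>X\<close> itself it
  expands the generating function of \<open>X\<close>, and along the number of summands it conditions a random sum.
\<close>

lemma sums_integral_fibres:
  fixes f :: "'a \<Rightarrow> real" and Y :: "'a \<Rightarrow> nat"
  assumes f: "integrable M f" and Y [measurable]: "Y \<in> measurable M (count_space UNIV)"
  shows "(\<lambda>k. \<integral>\<omega>. of_bool (Y \<omega> = k) * f \<omega> \<partial>M) sums (\<integral>\<omega>. f \<omega> \<partial>M)"
proof -
  have [measurable]: "f \<in> borel_measurable M" using f by auto
  have int: "integrable M (\<lambda>\<omega>. of_bool (Y \<omega> = k) * f \<omega>)" for k
    by (rule Bochner_Integration.integrable_bound[OF f]) auto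
  have eq: "(\<Sum>k<n. of_bool (Y \<omega> = k) * f \<omega>) = of_bool (Y \<omega> < n) * f \<omega>" for n \<omega>
    by (induction n) (auto simp: less_Suc_eq)
  have "(\<lambda>n. \<integral>\<omega>. of_bool (Y \<omega> < n) * f \<omega> \<partial>M) \<longlonglongrightarrow> (\<integral>\<omega>. f \<omega> \<partial>M)"
  proof (rule integral_dominated_convergence[where w = "\<lambda>\<omega>. \<bar>f \<omega>\<bar>"])
    show "AE \<omega> in M. (\<lambda>n. of_bool (Y \<omega> < n) * f \<omega>) \<longlonglongrightarrow> f \<omega>"
    proof (rule AE_I2)
      fix \<omega>
      have "eventually (\<lambda>n. of_bool (Y \<omega> < n) * f \<omega> = f \<omega>) sequentially"
        using eventually_gt_at_top[of "Y \<omega>"] by eventually_elim simp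
      then show "(\<lambda>n. of_bool (Y \<omega> < n) * f \<omega>) \<longlonglongrightarrow> f \<omega>"
        by (rule tendsto_eventually)
    qed
  qed (use f in auto)
  then show ?thesis
    unfolding sums_def by (simp add: eq int flip: Bochner_Integration.integral_sum)
qed

context prob_space
begin

lemma integrable_power_nat_valued:
  assumes [measurable]: "random_variable (count_space UNIV) X" and "\<bar>z\<bar> \<le> 1"
  shows "integrable M (\<lambda>\<omega>. z ^ X \<omega> :: real)"
  by (rule integrable_const_bound[where B = 1]) (use assms in \<open>auto simp: power_abs power_le_one\<close>)

lemma pgf_sums:
  assumes X [measurable]: "random_variable (count_space UNIV) X" and z: "\<bar>z\<bar> \<le> 1"
  shows "(\<lambda>k. prob {\<omega> \<in> space M. X \<omega> = k} * z ^ k) sums pgf M X z"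
proof -
  have "(\<integral>\<omega>. of_bool (X \<omega> = k) * z ^ X \<omega> \<partial>M) = prob {\<omega> \<in> space M. X \<omega> = k} * z ^ k" for k
  proof -
    have "(\<integral>\<omega>. of_bool (X \<omega> = k) * z ^ X \<omega> \<partial>M)
        = (\<integral>\<omega>. indicator {\<omega> \<in> space M. X \<omega> = k} \<omega> * z ^ k \<partial>M)"
      by (rule Bochner_Integration.integral_cong) (auto simp: indicator_def)
    then show ?thesis by simp
  qed
  with sums_integral_fibres[OF integrable_power_nat_valued[OF X z] X] show ?thesis
    by (simp add: pgf_def)
qed

lemma pgf_1 [simp]: "pgf M X 1 = 1"
  by (simp add: pgf_def prob_space)

lemma pgf_0:
  assumes "random_variable (count_space UNIV) X"
  shows "pgf M X 0 = prob {\<omega> \<in> space M. X \<omega> = 0}"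
  using sums_unique2[OF pgf_sums[OF assms, of 0] powser_sums_zero] by simp

lemma pgf_pos:
  assumes "random_variable (count_space UNIV) X" and "0 < z" "z \<le> 1"
  shows "0 < pgf M X z"
  unfolding pgf_def
  by (rule expectation_greater) (use assms in \<open>auto intro!: integrable_power_nat_valued\<close>)

lemma pgf_0_le:
  assumes "random_variable (count_space UNIV) X" and "0 \<le> z" "z \<le> 1"
  shows "pgf M X 0 \<le> pgf M X z"
  unfolding pgf_def
proof (rule integral_mono)
  show "0 ^ X \<omega> \<le> z ^ X \<omega>" for \<omega>
    using assms by (simp add: power_0_left)
qed (use assms in \<open>auto intro!: integrable_power_nat_valued\<close>)

text \<open>A variable that is almost surely positive has a generating function below the identity.\<close>

lemma pgf_le_pgf_0_add:
  assumes "random_variable (count_space UNIV) X" and "0 \<le> z" "z \<le> 1"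
  shows "pgf M X z \<le> pgf M X 0 + z"
proof -
  have "z ^ k \<le> 0 ^ k + z" for k
    using assms power_decreasing[of 1 k z] by (cases "k = 0") (auto simp: power_0_left)
  then have "pgf M X z \<le> (\<integral>\<omega>. 0 ^ X \<omega> + z \<partial>M)"
    unfolding pgf_def
    by (intro integral_mono) (use assms in \<open>auto intro!: integrable_power_nat_valued\<close>)
  also have "\<dots> = pgf M X 0 + z"
    unfolding pgf_def using assms by (subst Bochner_Integration.integral_add)
      (auto intro!: integrable_power_nat_valued simp: prob_space)
  finally show ?thesis .
qed

text \<open>
  Values in the naturals, without infinity, make the generating function left continuous at 1. This
  is how total mass 1 is used to fix the constant left undetermined for \<open>z < 1\<close>.
\<close>

lemma pgf_tendsto_1:
  assumes X [measurable]: "random_variable (count_space UNIV) X"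
  shows "(\<lambda>n. pgf M X (1 - 1 / real (Suc n))) \<longlonglongrightarrow> 1"
proof -
  have "(\<lambda>n. \<integral>\<omega>. (1 - 1 / real (Suc n)) ^ X \<omega> \<partial>M) \<longlonglongrightarrow> (\<integral>\<omega>. 1 \<partial>M)"
  proof (rule integral_dominated_convergence[where w = "\<lambda>_. 1"])
    have "(\<lambda>n. (1 - 1 / real (Suc n)) ^ k) \<longlonglongrightarrow> (1 - 0) ^ k" for k
      by (intro tendsto_intros LIMSEQ_Suc[OF lim_1_over_n])
    then show "AE \<omega> in M. (\<lambda>n. (1 - 1 / real (Suc n)) ^ X \<omega>) \<longlonglongrightarrow> 1" by simp
    show "AE \<omega> in M. norm ((1 - 1 / real (Suc n)) ^ X \<omega>) \<le> 1" for n
    proof (rule AE_I2)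
      fix \<omega>
      have "\<bar>1 - 1 / real (Suc n)\<bar> \<le> 1" by simp
      then show "norm ((1 - 1 / real (Suc n)) ^ X \<omega>) \<le> 1"
        by (simp only: real_norm_def power_abs power_le_one abs_ge_zero)
    qed
  qed simp_all
  then show ?thesis by (simp add: pgf_def prob_space)
qed

end

text \<open>
  The identity theorem for power series from one side only: after division by the lowest power with
  a nonzero coefficient, a difference that vanishes to the right of 0 has that coefficient as its
  limit at 0.
\<close>

lemma powser_eq_on_unit_interval_imp_eq:
  fixes a b :: "nat \<Rightarrow> real"
  assumes a: "\<And>z. 0 \<le> z \<Longrightarrow> z < 1 \<Longrightarrow> (\<lambda>k. a k * z ^ k) sums f z"
    and b: "\<And>z. 0 \<le> z \<Longrightarrow> z < 1 \<Longrightarrow> (\<lambda>k. b k * z ^ k) sums f z"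
  shows "a = b"
proof (rule ccontr)
  assume "a \<noteq> b"
  define d where "d k = a k - b k" for k
  from \<open>a \<noteq> b\<close> have ex: "\<exists>k. d k \<noteq> 0" by (auto simp: d_def)
  define m where "m = (LEAST k. d k \<noteq> 0)"
  have dm: "d m \<noteq> 0" using ex unfolding m_def by (rule LeastI_ex)
  have below: "d k = 0" if "k < m" for k using not_less_Least that unfolding m_def by blast
  have d0: "(\<lambda>k. d k * z ^ k) sums 0" if "0 \<le> z" "z < 1" for z
    using sums_diff[OF a b, OF that that] by (simp add: d_def algebra_simps)
  have shift: "(\<lambda>k. d (k + m) * z ^ k) sums 0" if "0 < z" "z < 1" for z
  proof -
    have "(\<lambda>k. d (k + m) * z ^ (k + m)) sums 0"
    proof (subst sums_iff_shift)
      have "(\<Sum>k<m. d k * z ^ k) = 0" using below by (intro sum.neutral) auto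
      then show "(\<lambda>k. d k * z ^ k) sums (0 + (\<Sum>k<m. d k * z ^ k))"
        using d0[of z] that by simp
    qed
    then have "(\<lambda>k. d (k + m) * z ^ (k + m) / z ^ m) sums (0 / z ^ m)"
      by (rule sums_divide)
    with that show ?thesis by (simp add: power_add)
  qed
  have "(\<lambda>k. d (k + m) * x ^ k) sums (\<Sum>k. d (k + m) * x ^ k)" if x: "norm x < 1" for x
  proof -
    obtain y where y: "norm x < y" "y < 1" using dense[OF x] by blast
    then have "0 < y" using norm_ge_zero[of x] by linarith
    with shift[of y] y have "summable (\<lambda>k. d (k + m) * y ^ k)" by (auto dest: sums_summable)
    then have "summable (\<lambda>k. d (k + m) * x ^ k)"
      by (rule powser_inside) (use y \<open>0 < y\<close> in simp)
    then show ?thesis by (rule summable_sums)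
  qed
  then have "((\<lambda>x. \<Sum>k. d (k + m) * x ^ k) \<longlongrightarrow> d (0 + m)) (at 0)"
    by (rule powser_limit_0[OF zero_less_one])
  then have lim: "((\<lambda>x. \<Sum>k. d (k + m) * x ^ k) \<longlongrightarrow> d (0 + m)) (at_right 0)"
    by (rule tendsto_within_subset) simp
  have "eventually (\<lambda>x. (\<Sum>k. d (k + m) * x ^ k) = 0) (at_right (0::real))"
    using eventually_at_right_real[OF zero_less_one]
  proof eventually_elim
    case (elim x)
    then show ?case by (intro sums_unique[symmetric] shift) auto
  qed
  then have "((\<lambda>x. \<Sum>k. d (k + m) * x ^ k) \<longlongrightarrow> 0) (at_right 0)"
    by (rule tendsto_eventually)
  from tendsto_unique[OF trivial_limit_at_right_real lim this] have "d m = 0" by simp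
  with dm show False by simp
qed

lemma distr_eq_if_pgf_eq:
  assumes "prob_space P" "prob_space Q"
    and X: "X \<in> measurable P (count_space UNIV)" and Y: "Y \<in> measurable Q (count_space UNIV)"
    and eq: "\<And>z. 0 \<le> z \<Longrightarrow> z < 1 \<Longrightarrow> pgf P X z = pgf Q Y z"
  shows "distr P (count_space UNIV) X = distr Q (count_space UNIV) Y"
proof -
  interpret P: prob_space P by fact
  interpret Q: prob_space Q by fact
  have "(\<lambda>k. measure P {\<omega> \<in> space P. X \<omega> = k}) = (\<lambda>k. measure Q {\<omega> \<in> space Q. Y \<omega> = k})"
  proof (rule powser_eq_on_unit_interval_imp_eq[where f = "pgf P X"])
    fix z :: real assume z: "0 \<le> z" "z < 1"
    show "(\<lambda>k. measure P {\<omega> \<in> space P. X \<omega> = k} * z ^ k) sums pgf P X z"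
      by (rule P.pgf_sums[OF X]) (use z in simp)
    show "(\<lambda>k. measure Q {\<omega> \<in> space Q. Y \<omega> = k} * z ^ k) sums pgf P X z"
      unfolding eq[OF z] by (rule Q.pgf_sums[OF Y]) (use z in simp)
  qed
  note masses = fun_cong[OF this]
  show ?thesis
  proof (rule measure_eqI_countable[where A = UNIV])
    fix k :: nat
    have "X -` {k} \<inter> space P = {\<omega> \<in> space P. X \<omega> = k}"
      and "Y -` {k} \<inter> space Q = {\<omega> \<in> space Q. Y \<omega> = k}" by auto
    then show "emeasure (distr P (count_space UNIV) X) {k} = emeasure (distr Q (count_space UNIV) Y) {k}"
      using masses[of k]
      by (simp add: emeasure_distr[OF X] emeasure_distr[OF Y] P.emeasure_eq_measure Q.emeasure_eq_measure)
  qed auto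
qed

section \<open>The generating function of a Bell-Touchard process\<close>

context prob_space
begin

lemma measurable_counting_process:
  "counting_process N \<Longrightarrow> 0 \<le> t \<Longrightarrow> random_variable (count_space UNIV) (N t)"
  by (simp add: counting_process_def)

lemma measurable_increment:
  assumes "counting_process N" "0 \<le> u" "0 \<le> v"
  shows "random_variable (count_space UNIV) (\<lambda>\<omega>. N v \<omega> - N u \<omega>)"
  using measurable_counting_process[OF assms(1,2)] measurable_counting_process[OF assms(1,3)]
  by measurable

lemma distr_increment:
  assumes "counting_process N" "\<forall>\<omega>\<in>space M. N 0 \<omega> = 0" "stationary_increments N" "0 \<le> u" "0 \<le> s"
  shows "distr M (count_space UNIV) (\<lambda>\<omega>. N (u + s) \<omega> - N u \<omega>) = distr M (count_space UNIV) (N s)"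
proof -
  have "distr M (count_space UNIV) (\<lambda>\<omega>. N (u + s) \<omega> - N u \<omega>)
      = distr M (count_space UNIV) (\<lambda>\<omega>. N (0 + s) \<omega> - N 0 \<omega>)"
    using assms unfolding stationary_increments_def by blast
  also have "\<dots> = distr M (count_space UNIV) (N s)"
    using assms(2) by (intro distr_cong) auto
  finally show ?thesis .
qed

text \<open>
  The increments over \<open>n\<close> pieces of length \<open>t / n\<close> are independent, distributed as \<open>N (t / n)\<close>, and
  add up to \<open>N t\<close>. The case \<open>z = 0\<close> is the statement about the probability of no event.
\<close>

lemma stationary_independent_pgf_eq_power:
  fixes n :: nat
  assumes N: "counting_process N" "\<forall>\<omega>\<in>space M. N 0 \<omega> = 0"
      "stationary_increments N" "independent_increments N"
    and t: "0 < t" and n: "0 < n" and z: "\<bar>z\<bar> \<le> 1"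
  shows "pgf M (N t) z = pgf M (N (t / n)) z ^ n"
proof -
  define \<tau> where "\<tau> i = t / n * real i" for i
  define D where "D i \<omega> = N (\<tau> (Suc i)) \<omega> - N (\<tau> i) \<omega>" for i \<omega>
  have \<tau>: "0 \<le> \<tau> i" "\<tau> i \<le> \<tau> (Suc i)" "\<tau> (Suc i) = \<tau> i + t / n" for i
    using t n by (auto simp: \<tau>_def field_simps)
  have D_rv: "random_variable (count_space UNIV) (D i)" for i
    unfolding D_def by (intro measurable_increment N \<tau>)
  have "0 \<le> \<tau> 0 \<and> strict_mono_on {..n} \<tau>"
    using t n by (auto simp: \<tau>_def strict_mono_on_def field_simps)
  then have "indep_vars (\<lambda>_. count_space UNIV) D {..<n}"
    using N(4) unfolding independent_increments_def D_def by blast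
  then have indep: "indep_vars (\<lambda>_. borel) (\<lambda>i \<omega>. z ^ D i \<omega>) {..<n}"
    by (rule indep_vars_compose2) auto
  have telescope: "(\<Sum>i<m. D i \<omega>) = N (\<tau> m) \<omega>" if "\<omega> \<in> space M" for m \<omega>
  proof (induction m)
    case 0
    then show ?case using N(2) that by (simp add: \<tau>_def)
  next
    case (Suc m)
    have "N (\<tau> m) \<omega> \<le> N (\<tau> (Suc m)) \<omega>"
      using N(1) that \<tau> unfolding counting_process_def by (auto intro: mono_onD)
    with Suc show ?case by (simp add: D_def)
  qed
  have increment: "(\<integral>\<omega>. z ^ D i \<omega> \<partial>M) = pgf M (N (t / n)) z" for i
  proof -
    have "(\<integral>\<omega>. z ^ D i \<omega> \<partial>M) = (\<integral>k. z ^ k \<partial>distr M (count_space UNIV) (D i))"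
      by (subst integral_distr) (auto intro: D_rv)
    also have "distr M (count_space UNIV) (D i) = distr M (count_space UNIV) (N (t / n))"
      unfolding D_def \<tau>(3) using t by (intro distr_increment N \<tau>) simp
    also have "(\<integral>k. z ^ k \<partial>distr M (count_space UNIV) (N (t / n))) = pgf M (N (t / n)) z"
      unfolding pgf_def using t
      by (subst integral_distr) (auto intro!: measurable_counting_process N)
    finally show ?thesis .
  qed
  have "\<tau> n = t" using n by (simp add: \<tau>_def)
  then have "pgf M (N t) z = (\<integral>\<omega>. (\<Prod>i<n. z ^ D i \<omega>) \<partial>M)"
    unfolding pgf_def by (intro Bochner_Integration.integral_cong) (auto simp flip: telescope power_sum)
  also have "\<dots> = (\<Prod>i<n. \<integral>\<omega>. z ^ D i \<omega> \<partial>M)"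
    by (rule indep_vars_lebesgue_integral[OF _ indep])
      (auto intro!: integrable_power_nat_valued D_rv z)
  also have "\<dots> = pgf M (N (t / n)) z ^ n"
    by (simp add: increment)
  finally show ?thesis .
qed

text \<open>
  If an event almost surely occurred before \<open>t\<close>, then by stationarity and independence one would occur
  in each of \<open>n\<close> pieces of \<open>[0, t]\<close>, for every \<open>n\<close>, and \<open>N t\<close> would be infinite. In terms of
  generating functions, the value at 1/2 would be at most \<open>(1/2) ^ n\<close> for every \<open>n\<close>.
\<close>

lemma stationary_independent_pgf_0_pos:
  assumes N: "counting_process N" "\<forall>\<omega>\<in>space M. N 0 \<omega> = 0"
      "stationary_increments N" "independent_increments N"
    and t: "0 < t"
  shows "0 < pgf M (N t) 0"
proof (rule ccontr)
  assume "\<not> 0 < pgf M (N t) 0"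
  moreover have rv: "random_variable (count_space UNIV) (N s)" if "0 \<le> s" for s
    using measurable_counting_process N(1) that by blast
  ultimately have "pgf M (N t) 0 = 0"
    using t pgf_0[of "N t"] by (simp add: order_less_le)
  have bound: "pgf M (N t) (1/2) \<le> (1/2) ^ Suc n" for n
  proof -
    define s where "s = t / real (Suc n)"
    have s: "0 < s" using t by (simp add: s_def)
    have "pgf M (N s) 0 = 0"
      using stationary_independent_pgf_eq_power[OF N t, of "Suc n" 0] \<open>pgf M (N t) 0 = 0\<close>
      by (simp add: s_def del: power_Suc of_nat_Suc)
    then have "pgf M (N s) (1/2) \<le> 1/2"
      using pgf_le_pgf_0_add[OF rv, of s "1/2"] s by simp
    moreover have "0 < pgf M (N s) (1/2)"
      using pgf_pos[OF rv] s by simp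
    ultimately show ?thesis
      using stationary_independent_pgf_eq_power[OF N t, of "Suc n" "1/2"]
      by (auto simp: s_def simp del: power_Suc of_nat_Suc intro!: power_mono)
  qed
  have "(\<lambda>n. (1/2::real) ^ Suc n) \<longlonglongrightarrow> 0"
    by real_asymp
  then have "pgf M (N t) (1/2) \<le> 0"
    by (rule LIMSEQ_le_const) (use bound in blast)
  with pgf_pos[OF rv, of t "1/2"] t show False by simp
qed

end

lemma root_scaled_limit:
  fixes g :: "nat \<Rightarrow> real"
  assumes "\<And>n. 0 \<le> g n" and "\<And>n. g n ^ Suc n = G" and "0 < G"
  shows "(\<lambda>n. real (Suc n) * (g n - 1)) \<longlonglongrightarrow> ln G"
proof -
  have "g n = exp (ln G / real (Suc n))" for n
  proof (rule power_eq_imp_eq_base[where n = "Suc n"])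
    show "g n ^ Suc n = exp (ln G / real (Suc n)) ^ Suc n"
      using assms by (simp flip: exp_of_nat_mult del: power_Suc of_nat_Suc)
  qed (use assms in auto)
  moreover have "(\<lambda>n. real (Suc n) * (exp (c / real (Suc n)) - 1)) \<longlonglongrightarrow> c" for c :: real
    by real_asymp
  ultimately show ?thesis by simp
qed

context prob_space
begin

text \<open>
  The infinitesimal axiom only speaks of increments that start at a positive time; stationarity
  moves it from the start time 1 to the start time 0.
\<close>

lemma bell_touchard_prob_limit:
  assumes BT: "bell_touchard_process \<alpha> \<theta> N" and t: "0 < t" and k: "1 \<le> k"
  shows "(\<lambda>n. real (Suc n) * prob {\<omega> \<in> space M. N (t / real (Suc n)) \<omega> = k})
           \<longlonglongrightarrow> t * \<alpha> * (\<theta> ^ k / fact k)"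
proof -
  have N: "counting_process N" "\<forall>\<omega>\<in>space M. N 0 \<omega> = 0" "stationary_increments N"
    using BT by (auto simp: bell_touchard_process_def)
  have eq: "prob {\<omega> \<in> space M. N (1 + s) \<omega> - N 1 \<omega> = k} = prob {\<omega> \<in> space M. N s \<omega> = k}"
    if "0 < s" for s
  proof -
    have "measure (distr M (count_space UNIV) (\<lambda>\<omega>. N (1 + s) \<omega> - N 1 \<omega>)) {k}
        = measure (distr M (count_space UNIV) (N s)) {k}"
      using distr_increment[OF N, of 1 s] that by simp
    then show ?thesis
      using that measurable_increment[OF N(1), of 1 "1 + s"] measurable_counting_process[OF N(1), of s]
      by (simp add: measure_distr vimage_def Int_def conj_commute)
  qed
  have "((\<lambda>s. (prob {\<omega> \<in> space M. N (1 + s) \<omega> - N 1 \<omega> = k} - \<alpha> * s * (\<theta> ^ k / fact k)) / s)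
      \<longlongrightarrow> 0) (at_right 0)"
    using BT k unfolding bell_touchard_process_def by (auto intro: smalloD_tendsto)
  moreover have "filterlim (\<lambda>n. t / real (Suc n)) (at_right 0) sequentially"
    using t by real_asymp
  ultimately have lim: "(\<lambda>n. (prob {\<omega> \<in> space M. N (1 + t / real (Suc n)) \<omega> - N 1 \<omega> = k}
      - \<alpha> * (t / real (Suc n)) * (\<theta> ^ k / fact k)) / (t / real (Suc n))) \<longlonglongrightarrow> 0"
    by (rule filterlim_compose)
  have "prob {\<omega> \<in> space M. N (1 + t / real (Suc n)) \<omega> - N 1 \<omega> = k}
      = prob {\<omega> \<in> space M. N (t / real (Suc n)) \<omega> = k}" for n
    by (rule eq) (use t in simp)
  note lim = lim[unfolded this]
  from tendsto_add[OF tendsto_mult_left[OF lim, of t] tendsto_const[of "t * \<alpha> * (\<theta> ^ k / fact k)"]]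
  show ?thesis
    using t by (simp add: field_simps del: of_nat_Suc)
qed

text \<open>
  Both sides are the limit of \<open>n * (pgf M (N (t / n)) z - 1)\<close>: the left side through \<open>n\<close>-th roots,
  the right side coefficient by coefficient, where the constant coefficient is again a limit of roots.
\<close>

lemma bell_touchard_ln_pgf:
  assumes BT: "bell_touchard_process \<alpha> \<theta> N" and t: "0 < t" and z: "0 \<le> z" "z < 1"
  shows "ln (pgf M (N t) z) = ln (pgf M (N t) 0) + t * \<alpha> * (exp (\<theta> * z) - 1)"
proof -
  have N: "counting_process N" "\<forall>\<omega>\<in>space M. N 0 \<omega> = 0"
      "stationary_increments N" "independent_increments N"
    using BT by (auto simp: bell_touchard_process_def)
  define s where "s n = t / real (Suc n)" for n
  have s: "0 < s n" for n using t by (simp add: s_def)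
  have rv: "random_variable (count_space UNIV) (N (s n))" for n
    using measurable_counting_process[OF N(1)] s less_imp_le by blast
  have rvt: "random_variable (count_space UNIV) (N t)"
    using measurable_counting_process[OF N(1)] t less_imp_le by blast
  define q where "q k n = prob {\<omega> \<in> space M. N (s n) \<omega> = k}" for k n
  have scaled: "(\<lambda>n. real (Suc n) * (pgf M (N (s n)) y - 1)) \<longlonglongrightarrow> ln (pgf M (N t) y)"
    if "0 \<le> y" "y < 1" for y
  proof (rule root_scaled_limit)
    show "0 \<le> pgf M (N (s n)) y" for n
      unfolding pgf_def using that by simp
    show "pgf M (N (s n)) y ^ Suc n = pgf M (N t) y" for n
      using stationary_independent_pgf_eq_power[OF N t, of "Suc n" y] that by (simp add: s_def)
    show "0 < pgf M (N t) y"
      using stationary_independent_pgf_0_pos[OF N t] pgf_0_le[OF rvt, of y] that by simp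
  qed
  \<comment> \<open>The total rate of events times \<open>t\<close>: it dominates the rescaled probability of each positive
    count, uniformly in \<open>n\<close>, because \<open>1 - y \<le> - ln y\<close>.\<close>
  define \<Lambda> where "\<Lambda> = - ln (pgf M (N t) 0)"
  have bound: "real (Suc n) * q (Suc k) n \<le> \<Lambda>" for k n
  proof -
    have pos: "0 < pgf M (N (s n)) 0" using stationary_independent_pgf_0_pos[OF N s] .
    have "ln (pgf M (N t) 0) = real (Suc n) * ln (pgf M (N (s n)) 0)"
      using stationary_independent_pgf_eq_power[OF N t, of "Suc n" 0] pos
      by (simp add: s_def ln_realpow del: power_Suc of_nat_Suc)
    moreover have "ln (pgf M (N (s n)) 0) \<le> pgf M (N (s n)) 0 - 1"
      using pos by (rule ln_le_minus_one)
    moreover have "q (Suc k) n \<le> 1 - pgf M (N (s n)) 0"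
    proof -
      have [measurable]: "random_variable (count_space UNIV) (N (s n))" by (rule rv)
      have "q (Suc k) n + pgf M (N (s n)) 0
          = prob ({\<omega> \<in> space M. N (s n) \<omega> = Suc k} \<union> {\<omega> \<in> space M. N (s n) \<omega> = 0})"
        unfolding q_def pgf_0[OF rv]
        by (rule finite_measure_Union[symmetric]) auto
      also have "\<dots> \<le> 1" by (rule prob_le_1)
      finally show ?thesis by simp
    qed
    ultimately show ?thesis
      unfolding \<Lambda>_def by (smt (verit) mult_left_mono mult_minus_right of_nat_0_le_iff)
  qed
  have split: "real (Suc n) * (pgf M (N (s n)) z - 1) - real (Suc n) * (pgf M (N (s n)) 0 - 1)
      = (\<Sum>k. real (Suc n) * q (Suc k) n * z ^ Suc k)" for n
  proof -
    have "(\<lambda>k. q k n * z ^ k) sums pgf M (N (s n)) z"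
      unfolding q_def using pgf_sums[OF rv] z by simp
    then have "(\<lambda>k. q (Suc k) n * z ^ Suc k) sums (pgf M (N (s n)) z - pgf M (N (s n)) 0)"
      by (subst sums_Suc_iff) (simp add: q_def pgf_0[OF rv])
    from sums_mult[OF this, of "real (Suc n)"] show ?thesis
      by (simp add: sums_iff algebra_simps)
  qed
  have tannery: "eventually (\<lambda>n. summable (\<lambda>k. norm (real (Suc n) * q (Suc k) n * z ^ Suc k))) sequentially \<and>
      summable (\<lambda>k. norm (t * \<alpha> * (\<theta> ^ Suc k / fact (Suc k)) * z ^ Suc k)) \<and>
      (\<lambda>n. \<Sum>k. real (Suc n) * q (Suc k) n * z ^ Suc k)
        \<longlonglongrightarrow> (\<Sum>k. t * \<alpha> * (\<theta> ^ Suc k / fact (Suc k)) * z ^ Suc k)"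
  proof (rule tannerys_theorem[where M = "\<lambda>k. \<Lambda> * z ^ Suc k"])
    show "(\<lambda>n. real (Suc n) * q (Suc k) n * z ^ Suc k)
        \<longlonglongrightarrow> t * \<alpha> * (\<theta> ^ Suc k / fact (Suc k)) * z ^ Suc k" for k
      unfolding q_def s_def by (intro tendsto_mult_right bell_touchard_prob_limit[OF BT t]) simp
    have "norm (real (Suc n) * q (Suc k) n * z ^ Suc k) \<le> \<Lambda> * z ^ Suc k" for k n
      using mult_right_mono[OF bound, of "z ^ Suc k" n k] z
      by (simp add: abs_mult q_def del: of_nat_Suc power_Suc)
    then show "eventually (\<lambda>(k, n). norm (real (Suc n) * q (Suc k) n * z ^ Suc k) \<le> \<Lambda> * z ^ Suc k)
        (at_top \<times>\<^sub>F sequentially)"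
      by (intro always_eventually) auto
    show "summable (\<lambda>k. \<Lambda> * z ^ Suc k)"
      using z by (intro summable_mult) (simp add: summable_Suc_iff summable_geometric)
  qed simp
  have lim: "(\<lambda>n. \<Sum>k. real (Suc n) * q (Suc k) n * z ^ Suc k)
      \<longlonglongrightarrow> ln (pgf M (N t) z) - ln (pgf M (N t) 0)"
    unfolding split[symmetric] using z by (intro tendsto_diff scaled) auto
  have series: "(\<lambda>k. t * \<alpha> * (\<theta> ^ Suc k / fact (Suc k)) * z ^ Suc k) sums (t * \<alpha> * (exp (\<theta> * z) - 1))"
  proof -
    have "(\<lambda>k. (\<theta> * z) ^ k / fact k) sums exp (\<theta> * z)"
      using exp_converges[of "\<theta> * z"] by (simp add: field_simps)
    then have "(\<lambda>k. (\<theta> * z) ^ Suc k / fact (Suc k)) sums (exp (\<theta> * z) - 1)"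
      by (subst sums_Suc_iff) simp
    from sums_mult[OF this, of "t * \<alpha>"] show ?thesis
      by (simp add: power_mult_distrib mult_ac del: power_Suc fact_Suc)
  qed
  have "(\<lambda>n. \<Sum>k. real (Suc n) * q (Suc k) n * z ^ Suc k)
      \<longlonglongrightarrow> t * \<alpha> * (exp (\<theta> * z) - 1)"
    unfolding sums_unique[OF series] using tannery by blast
  from LIMSEQ_unique[OF lim this]
  have "ln (pgf M (N t) z) - ln (pgf M (N t) 0) = t * \<alpha> * (exp (\<theta> * z) - 1)" .
  then show ?thesis by simp
qed

text \<open>
  Letting \<open>z\<close> tend to 1 in the formula for the logarithm shows that the total rate of events is the
  sum \<open>\<alpha> * (exp \<theta> - 1)\<close> of the rates of the individual jump sizes.
\<close>

lemma bell_touchard_pgf: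
  assumes BT: "bell_touchard_process \<alpha> \<theta> N" and t: "0 \<le> t" and z: "0 \<le> z" "z < 1"
  shows "pgf M (N t) z = exp (t * \<alpha> * (exp (\<theta> * z) - exp \<theta>))"
proof (cases "t = 0")
  case True
  then have "pgf M (N t) z = (\<integral>\<omega>. 1 \<partial>M)"
    unfolding pgf_def using BT
    by (intro Bochner_Integration.integral_cong) (auto simp: bell_touchard_process_def)
  with True show ?thesis by (simp add: prob_space)
next
  case False
  with t have t: "0 < t" by simp
  have N: "counting_process N" "\<forall>\<omega>\<in>space M. N 0 \<omega> = 0"
      "stationary_increments N" "independent_increments N"
    using BT by (auto simp: bell_touchard_process_def)
  have rv: "random_variable (count_space UNIV) (N t)"
    using measurable_counting_process[OF N(1)] t less_imp_le by blast
  have pos0: "0 < pgf M (N t) 0" using stationary_independent_pgf_0_pos[OF N t] .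
  have form: "pgf M (N t) y = pgf M (N t) 0 * exp (t * \<alpha> * (exp (\<theta> * y) - 1))"
    if y: "0 \<le> y" "y < 1" for y
  proof -
    have "0 < pgf M (N t) y" using pos0 pgf_0_le[OF rv, of y] y by simp
    then have "pgf M (N t) y = exp (ln (pgf M (N t) y))" by simp
    also have "\<dots> = pgf M (N t) 0 * exp (t * \<alpha> * (exp (\<theta> * y) - 1))"
      unfolding bell_touchard_ln_pgf[OF BT t y] using pos0 by (simp add: exp_add)
    finally show ?thesis .
  qed
  have "(\<lambda>n. 1 - 1 / real (Suc n)) \<longlonglongrightarrow> 1" by real_asymp
  then have "(\<lambda>n. pgf M (N t) 0 * exp (t * \<alpha> * (exp (\<theta> * (1 - 1 / real (Suc n))) - 1)))
      \<longlonglongrightarrow> pgf M (N t) 0 * exp (t * \<alpha> * (exp (\<theta> * 1) - 1))"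
    by (intro tendsto_intros)
  moreover have "pgf M (N t) (1 - 1 / real (Suc n))
      = pgf M (N t) 0 * exp (t * \<alpha> * (exp (\<theta> * (1 - 1 / real (Suc n))) - 1))" for n
    by (rule form) (auto simp: field_simps)
  ultimately have "pgf M (N t) 0 * exp (t * \<alpha> * (exp \<theta> - 1)) = 1"
    using pgf_tendsto_1[OF rv] LIMSEQ_unique by force
  then have "pgf M (N t) 0 = exp (- (t * \<alpha> * (exp \<theta> - 1)))"
    unfolding exp_minus by (metis inverse_unique mult.commute)
  then show ?thesis
    unfolding form[OF z] by (simp add: exp_add[symmetric] algebra_simps)
qed

section \<open>The generating function of a random sum\<close>

lemma measurable_nat_sum:
  fixes X :: "'i \<Rightarrow> 'c \<Rightarrow> nat"
  assumes "\<And>i. i \<in> I \<Longrightarrow> X i \<in> measurable F (count_space UNIV)"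
  shows "(\<lambda>\<omega>. \<Sum>i\<in>I. X i \<omega>) \<in> measurable F (count_space UNIV)"
  using assms
proof (induction I rule: infinite_finite_induct)
  case (insert i I)
  have [measurable]: "X i \<in> measurable F (count_space UNIV)"
     "(\<lambda>\<omega>. \<Sum>i\<in>I. X i \<omega>) \<in> measurable F (count_space UNIV)"
    using insert by auto
  show ?case using insert.hyps by simp
qed auto

text \<open>
  A sum over part of the first family is measurable for the sigma-algebra which that family generates,
  so independence of the families passes to it.
\<close>

lemma indep_var_partial_sum:
  fixes X :: "'i \<Rightarrow> 'a \<Rightarrow> nat"
  assumes indep: "indep_families (count_space UNIV) X I (count_space UNIV) Y J"
    and X: "\<And>i. i \<in> I \<Longrightarrow> random_variable (count_space UNIV) (X i)"
    and Y: "random_variable (count_space UNIV) (Y j)" and j: "j \<in> J" and K: "K \<subseteq> I"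
  shows "indep_var (count_space UNIV) (\<lambda>\<omega>. \<Sum>i\<in>K. X i \<omega>) (count_space UNIV) (Y j)"
proof -
  define S where "S \<omega> = (\<Sum>i\<in>K. X i \<omega>)" for \<omega>
  define F where "F = sigma (space M) (\<Union>i\<in>I. {X i -` A \<inter> space M | A. A \<in> sets (count_space UNIV)})"
  have sets_F: "sets F = generated_sigma (count_space UNIV) X I" and space_F: "space F = space M"
    unfolding F_def generated_sigma_def
    by (auto intro!: sets_measure_of simp: space_measure_of_conv)
  have "X i \<in> measurable F (count_space UNIV)" if "i \<in> I" for i
    using that by (intro measurableI) (auto simp: sets_F space_F generated_sigma_def intro!: sigma_sets.Basic)
  then have "S \<in> measurable F (count_space UNIV)"
    unfolding S_def using K by (intro measurable_nat_sum) auto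
  from measurable_sets[OF this]
  have "{S -` A \<inter> space M | A. A \<in> sets (count_space UNIV)} \<subseteq> sets F"
    unfolding space_F by blast
  then have S_sub: "sigma_sets (space M) {S -` A \<inter> space M | A. A \<in> sets (count_space UNIV)}
      \<subseteq> generated_sigma (count_space UNIV) X I"
    using sets.sigma_sets_subset[of _ F] by (simp add: sets_F space_F)
  have Y_sub: "sigma_sets (space M) {Y j -` A \<inter> space M | A. A \<in> sets (count_space UNIV)}
      \<subseteq> generated_sigma (count_space UNIV) Y J"
    unfolding generated_sigma_def using j by (intro sigma_sets_mono') auto
  have "indep_set (sigma_sets (space M) {S -` A \<inter> space M | A. A \<in> sets (count_space UNIV)})
      (sigma_sets (space M) {Y j -` A \<inter> space M | A. A \<in> sets (count_space UNIV)})"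
    using indep S_sub Y_sub unfolding indep_families_def indep_sets2_eq by blast
  moreover have "random_variable (count_space UNIV) S"
    unfolding S_def using X K by (intro measurable_nat_sum) auto
  ultimately show ?thesis
    using Y unfolding indep_var_eq S_def by blast
qed

lemma measurable_random_sum:
  fixes X :: "nat \<Rightarrow> 'a \<Rightarrow> nat"
  assumes "\<And>i. 1 \<le> i \<Longrightarrow> random_variable (count_space UNIV) (X i)"
    and "random_variable (count_space UNIV) L"
  shows "random_variable (count_space UNIV) (\<lambda>\<omega>. \<Sum>i=1..L \<omega>. X i \<omega>)"
  by (rule measurable_compose_countable[OF measurable_nat_sum]) (use assms in auto)

text \<open>
  On the event that \<open>Y j = m\<close> the random sum is a sum of \<open>m\<close> independent terms, independent of that
  event, and contributes the probability of the event times \<open>\<phi> ^ m\<close>. Only the value at one point \<open>z\<close>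
  enters, hence the common value \<open>\<phi>\<close> instead of a common law.
\<close>

lemma pgf_random_sum:
  fixes X :: "nat \<Rightarrow> 'a \<Rightarrow> nat"
  assumes X_indep: "indep_vars (\<lambda>_. count_space UNIV) X {1..}"
    and indep: "indep_families (count_space UNIV) X {1..} (count_space UNIV) Y J"
    and Y [measurable]: "random_variable (count_space UNIV) (Y j)" and j: "j \<in> J"
    and \<phi>: "\<And>i. 1 \<le> i \<Longrightarrow> pgf M (X i) z = \<phi>" and z: "\<bar>z\<bar> \<le> 1"
  shows "pgf M (\<lambda>\<omega>. \<Sum>i=1..Y j \<omega>. X i \<omega>) z = pgf M (Y j) \<phi>"
proof -
  have X [measurable]: "random_variable (count_space UNIV) (X i)" if "1 \<le> i" for i
    using X_indep that unfolding indep_vars_def by auto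
  have S: "random_variable (count_space UNIV) (\<lambda>\<omega>. \<Sum>i=1..m. X i \<omega>)" for m
    by (intro measurable_nat_sum X) auto
  have pgf_S: "(\<integral>\<omega>. z ^ (\<Sum>i=1..m. X i \<omega>) \<partial>M) = \<phi> ^ m" for m
  proof -
    have "indep_vars (\<lambda>_. borel) (\<lambda>i \<omega>. z ^ X i \<omega>) {1..m}"
      by (rule indep_vars_compose2[OF indep_vars_subset[OF X_indep]]) auto
    then have "(\<integral>\<omega>. (\<Prod>i=1..m. z ^ X i \<omega>) \<partial>M) = (\<Prod>i=1..m. \<integral>\<omega>. z ^ X i \<omega> \<partial>M)"
      by (intro indep_vars_lebesgue_integral) (auto intro!: integrable_power_nat_valued X z)
    also have "\<dots> = \<phi> ^ m"
      using \<phi> by (simp add: pgf_def)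
    finally show ?thesis by (simp add: power_sum)
  qed
  have fibre: "(\<integral>\<omega>. of_bool (Y j \<omega> = m) * z ^ (\<Sum>i=1..Y j \<omega>. X i \<omega>) \<partial>M)
      = prob {\<omega> \<in> space M. Y j \<omega> = m} * \<phi> ^ m" for m
  proof -
    have "indep_var borel ((\<lambda>k. z ^ k) \<circ> (\<lambda>\<omega>. \<Sum>i=1..m. X i \<omega>)) borel ((\<lambda>k. of_bool (k = m) :: real) \<circ> Y j)"
      by (rule indep_var_compose[OF indep_var_partial_sum[OF indep X Y j]]) auto
    then have iv: "indep_var borel (\<lambda>\<omega>. z ^ (\<Sum>i=1..m. X i \<omega>)) borel (\<lambda>\<omega>. of_bool (Y j \<omega> = m) :: real)"
      by (simp add: comp_def)
    have "(\<integral>\<omega>. of_bool (Y j \<omega> = m) * z ^ (\<Sum>i=1..Y j \<omega>. X i \<omega>) \<partial>M)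
        = (\<integral>\<omega>. z ^ (\<Sum>i=1..m. X i \<omega>) * of_bool (Y j \<omega> = m) \<partial>M)"
      by (rule Bochner_Integration.integral_cong) auto
    also have "\<dots> = (\<integral>\<omega>. z ^ (\<Sum>i=1..m. X i \<omega>) \<partial>M) * (\<integral>\<omega>. of_bool (Y j \<omega> = m) \<partial>M)"
      by (rule indep_var_lebesgue_integral[OF iv integrable_power_nat_valued[OF S z]])
        (auto intro!: integrable_const_bound[where B = 1])
    also have "(\<integral>\<omega>. of_bool (Y j \<omega> = m) \<partial>M) = (\<integral>\<omega>. indicator {\<omega> \<in> space M. Y j \<omega> = m} \<omega> \<partial>M)"
      by (rule Bochner_Integration.integral_cong) (auto simp: indicator_def)
    finally show ?thesis unfolding pgf_S by simp
  qed
  have "\<bar>\<phi>\<bar> \<le> 1"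
  proof -
    have "\<bar>pgf M (X 1) z\<bar> \<le> (\<integral>\<omega>. \<bar>z ^ X 1 \<omega>\<bar> \<partial>M)"
      unfolding pgf_def by (rule integral_abs_bound)
    also have "\<dots> \<le> (\<integral>\<omega>. 1 \<partial>M)"
      by (rule integral_mono)
        (use z in \<open>auto intro!: integrable_power_nat_valued X simp: power_abs power_le_one\<close>)
    finally show ?thesis by (simp add: \<phi> prob_space)
  qed
  then have "(\<lambda>m. prob {\<omega> \<in> space M. Y j \<omega> = m} * \<phi> ^ m) sums pgf M (Y j) \<phi>"
    by (rule pgf_sums[OF Y])
  moreover have "(\<lambda>m. prob {\<omega> \<in> space M. Y j \<omega> = m} * \<phi> ^ m)
      sums pgf M (\<lambda>\<omega>. \<Sum>i=1..Y j \<omega>. X i \<omega>) z"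
    unfolding fibre[symmetric] pgf_def
    by (intro sums_integral_fibres integrable_power_nat_valued measurable_random_sum X Y z)
  ultimately show ?thesis by (rule sums_unique2[symmetric])
qed

lemma poisson_process_pgf:
  assumes PP: "poisson_process r L" and t: "0 \<le> t" and z: "\<bar>z\<bar> \<le> 1"
  shows "pgf M (L t) z = exp (r * t * (z - 1))"
proof (cases "t = 0")
  case True
  then have "pgf M (L t) z = (\<integral>\<omega>. 1 \<partial>M)"
    unfolding pgf_def using PP
    by (intro Bochner_Integration.integral_cong) (auto simp: poisson_process_def)
  with True show ?thesis by (simp add: prob_space)
next
  case False
  with t have t: "0 < t" by simp
  have r: "0 < r" and rv: "random_variable (count_space UNIV) (L t)" and L0: "\<forall>\<omega>\<in>space M. L 0 \<omega> = 0"
    using PP t by (auto simp: poisson_process_def counting_process_def)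
  have "prob {\<omega> \<in> space M. L t \<omega> = k} = (r * t) ^ k / fact k * exp (- (r * t))" for k
  proof -
    have "{\<omega> \<in> space M. L t \<omega> = k} = {\<omega> \<in> space M. L (0 + t) \<omega> - L 0 \<omega> = k}"
      using L0 by auto
    also have "prob \<dots> = pmf (poisson_pmf (r * t)) k"
      using PP t unfolding poisson_process_def by blast
    finally show ?thesis using r t by simp
  qed
  with pgf_sums[OF rv z]
  have "(\<lambda>k. (r * t) ^ k / fact k * exp (- (r * t)) * z ^ k) sums pgf M (L t) z" by simp
  moreover have "(\<lambda>k. (r * t) ^ k / fact k * exp (- (r * t)) * z ^ k) sums (exp (- (r * t)) * exp (r * t * z))"
    using sums_mult[OF exp_converges[of "r * t * z"], of "exp (- (r * t))"]
    by (simp add: power_mult_distrib field_simps)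
  ultimately have "pgf M (L t) z = exp (- (r * t)) * exp (r * t * z)" by (rule sums_unique2)
  then show ?thesis by (simp add: exp_add[symmetric] algebra_simps)
qed

text \<open>
  The prescribed masses on the positive integers already add up to 1, so the value 0 has probability
  0; comparing generating functions at 1 shows this.
\<close>

lemma zero_truncated_poisson_pgf:
  assumes X: "random_variable (count_space UNIV) X" and \<theta>: "0 < \<theta>"
    and prob_X: "\<And>x. 1 \<le> x \<Longrightarrow> prob {\<omega> \<in> space M. X \<omega> = x} = (\<theta> ^ x / fact x) / (exp \<theta> - 1)"
    and z: "\<bar>z\<bar> \<le> 1"
  shows "pgf M X z = (exp (\<theta> * z) - 1) / (exp \<theta> - 1)"
proof -
  have form: "pgf M X y = prob {\<omega> \<in> space M. X \<omega> = 0} + (exp (\<theta> * y) - 1) / (exp \<theta> - 1)"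
    if "\<bar>y\<bar> \<le> 1" for y
  proof -
    have "(\<lambda>k. (\<theta> * y) ^ k / fact k) sums exp (\<theta> * y)"
      using exp_converges[of "\<theta> * y"] by (simp add: field_simps)
    then have "(\<lambda>k. (\<theta> * y) ^ Suc k / fact (Suc k)) sums (exp (\<theta> * y) - 1)"
      by (subst sums_Suc_iff) simp
    from sums_divide[OF this, of "exp \<theta> - 1"]
    have "(\<lambda>k. prob {\<omega> \<in> space M. X \<omega> = Suc k} * y ^ Suc k) sums ((exp (\<theta> * y) - 1) / (exp \<theta> - 1))"
      by (simp add: prob_X power_mult_distrib del: power_Suc fact_Suc)
    then have "(\<lambda>k. prob {\<omega> \<in> space M. X \<omega> = k} * y ^ k) sums
        ((exp (\<theta> * y) - 1) / (exp \<theta> - 1) + prob {\<omega> \<in> space M. X \<omega> = 0} * y ^ 0)"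
      by (rule sums_Suc)
    from sums_unique2[OF pgf_sums[OF X that] this] show ?thesis by simp
  qed
  from form[of 1] \<theta> have "prob {\<omega> \<in> space M. X \<omega> = 0} = 0" by simp
  with form[OF z] show ?thesis by simp
qed

end

section \<open>Equality in law\<close>

theorem proposition3p3:
  fixes P :: "'a measure" and Q :: "'b measure"
    and \<alpha> \<theta> :: real
    and N :: "real \<Rightarrow> 'a \<Rightarrow> nat"
    and M :: "real \<Rightarrow> 'b \<Rightarrow> nat"
    and X :: "nat \<Rightarrow> 'b \<Rightarrow> nat"
  assumes "\<alpha> > 0" and "\<theta> > 0"
    and "prob_space P" and "prob_space Q"
    and "prob_space.bell_touchard_process P \<alpha> \<theta> N"
    and "prob_space.poisson_process Q (\<alpha> * (exp \<theta> - 1)) M"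
    and "prob_space.iid_vars Q (count_space UNIV) X {1..}"
    and "prob_space.indep_families Q (count_space UNIV) X {1..} (count_space UNIV) M {0..}"
    and "\<forall>i\<ge>1. \<forall>x\<ge>1.
           measure Q {\<omega> \<in> space Q. X i \<omega> = x} = (\<theta> ^ x / fact x) / (exp \<theta> - 1)"
  shows "\<forall>t\<ge>0. distr P (count_space UNIV) (N t) =
           distr Q (count_space UNIV) (\<lambda>\<omega>. \<Sum>i=1..M t \<omega>. X i \<omega>)"
proof (intro allI impI)
  fix t :: real assume t: "0 \<le> t"
  interpret P: prob_space P by fact
  interpret Q: prob_space Q by fact
  have X_indep: "Q.indep_vars (\<lambda>_. count_space UNIV) X {1..}"
    using assms(7) by (simp add: Q.iid_vars_def)
  then have X: "Q.random_variable (count_space UNIV) (X i)" if "1 \<le> i" for i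
    using that unfolding Q.indep_vars_def by auto
  have M: "Q.random_variable (count_space UNIV) (M t)"
    using assms(6) t by (auto simp: Q.poisson_process_def Q.counting_process_def)
  have N: "P.random_variable (count_space UNIV) (N t)"
    using assms(5) t by (auto simp: P.bell_touchard_process_def P.counting_process_def)
  show "distr P (count_space UNIV) (N t) = distr Q (count_space UNIV) (\<lambda>\<omega>. \<Sum>i=1..M t \<omega>. X i \<omega>)"
  proof (rule distr_eq_if_pgf_eq[OF assms(3,4) N Q.measurable_random_sum[OF X M]])
    fix z :: real assume z: "0 \<le> z" "z < 1"
    define \<phi> where "\<phi> = (exp (\<theta> * z) - 1) / (exp \<theta> - 1)"
    have "\<theta> * z \<le> \<theta>" using assms(2) z by (simp add: mult_left_le)
    then have \<phi>: "\<bar>\<phi>\<bar> \<le> 1"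
      using assms(2) z by (simp add: \<phi>_def)
    have "pgf Q (X i) z = \<phi>" if "1 \<le> i" for i
      unfolding \<phi>_def using assms(2,9) that z by (intro Q.zero_truncated_poisson_pgf X) auto
    then have "pgf Q (\<lambda>\<omega>. \<Sum>i=1..M t \<omega>. X i \<omega>) z = pgf Q (M t) \<phi>"
      using z t by (intro Q.pgf_random_sum[OF X_indep assms(8) M]) auto
    also have "\<dots> = exp (\<alpha> * (exp \<theta> - 1) * t * (\<phi> - 1))"
      by (rule Q.poisson_process_pgf[OF assms(6) t \<phi>])
    also have "\<alpha> * (exp \<theta> - 1) * t * (\<phi> - 1) = t * \<alpha> * (exp (\<theta> * z) - exp \<theta>)"
      using assms(2) by (simp add: \<phi>_def field_simps)
    also have "exp \<dots> = pgf P (N t) z"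
      by (rule P.bell_touchard_pgf[OF assms(5) t z, symmetric])
    finally show "pgf P (N t) z = pgf Q (\<lambda>\<omega>. \<Sum>i=1..M t \<omega>. X i \<omega>) z" ..
  qed simp
qed

end
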